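(* Let $q$ be a prime power, $E=\mathbb{F}_q^n$, and let $\Delta$ be a pure $q$-complex on $E$ of dimension $d$ with a shelling $F_1,\dots,F_t$. For $0\le i\le t$ let $\Delta_i=\langle F_1,\dots,F_i\rangle$. Assume there is an integer $1\le\ell\le t$ such that $\mathring{\Delta}_\ell$ is contractible, and that for every integer $i$ with $\ell<i\le t$, the set $\mathring{\Sigma}(F_i)\cap\mathring{\Delta}_{i-1}$ is the punctured $q$-sphere of $F_i$, i.e. equals the set of all subspaces of $F_i$ other than $\{\mathbf 0\}$ and $F_i$. Then $$\widetilde{H}_p(\mathring{\Delta})=\begin{cases}\widetilde{H}_{p-1}(\mathring{S}_q^{d-1})^{\oplus(t-\ell)}&\text{if }p=d-1,\\ 0&\text{if }p\ne d-1.\end{cases}$$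
   Context: A $q$-complex on $E$ is a set of subspaces of $E$ closed under taking subspaces; facets are its inclusion-maximal elements; its dimension is the maximal dimension of a member; it is pure if all facets have equal dimension. For a set $\mathcal{A}$ of subspaces, $\langle\mathcal{A}\rangle$ is the set of subspaces contained in some member of $\mathcal{A}$. A shelling is a linear order $F_1,\dots,F_t$ of the facets such that for each $j\ge2$, $\langle F_j\rangle\cap\langle F_1,\dots,F_{j-1}\rangle$ is generated by a nonempty set of subspaces of $F_j$ of dimension $\dim F_j-1$. For a $q$-complex $\Gamma$, $\mathring{\Gamma}=\Gamma\setminus\{\{\mathbf 0\}\}$; $\mathring{\Sigma}(F)$ is the set of nonzero subspaces of $F$; $\mathring{S}_q^{d-1}$ is the set of subspaces of $\mathbb{F}_q^d$ other than $\{\mathbf 0\}$ and $\mathbb{F}_q^d$. All these posets carry the order topology under inclusion (open sets = down-sets); $\widetilde{H}_p$ is reduced singular homology, with the convention that the empty space has $\widetilde{H}_{-1}=\mathbb{Z}$ and all other groups $0$. *)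

theory Defs
  imports "HOL-Homology.Homology" "HOL-Library.Function_Algebras"
begin

subsection \<open>The spaces \<open>F_q^n\<close>\<close>

text \<open>
  The field \<open>F_q\<close> is a type \<open>'k :: {field, finite}\<close> with \<open>q = CARD('k)\<close>. Since \<open>F_q^n\<close> and
  \<open>F_q^d\<close> occur together with \<open>d\<close> depending on the complex, \<open>F_q^n\<close> is the carrier set of those
  functions \<open>nat \<Rightarrow> 'k\<close> that vanish from index \<open>n\<close> on; linear algebra is that of the ambient
  vector space of all functions.
\<close>

definition fscale :: "'k::field \<Rightarrow> (nat \<Rightarrow> 'k) \<Rightarrow> nat \<Rightarrow> 'k"
  where "fscale c v = (\<lambda>i. c * v i)"

global_interpretation fv: vector_space "fscale :: 'k::field \<Rightarrow> (nat \<Rightarrow> 'k) \<Rightarrow> nat \<Rightarrow> 'k"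
  by unfold_locales (auto simp: fscale_def fun_eq_iff algebra_simps)

definition coord_space :: "nat \<Rightarrow> (nat \<Rightarrow> 'k::field) set"
  where "coord_space n = {v. \<forall>i\<ge>n. v i = 0}"

lemma subspace_coord_space: "fv.subspace (coord_space n :: (nat \<Rightarrow> 'k::field) set)"
  by (auto simp: fv.subspace_def coord_space_def fscale_def)


subsection \<open>\<open>q\<close>-complexes\<close>

definition q_complex :: "(nat \<Rightarrow> 'k::field) set \<Rightarrow> (nat \<Rightarrow> 'k) set set \<Rightarrow> bool"
  where "q_complex E \<Delta> \<longleftrightarrow>
    (\<forall>W\<in>\<Delta>. fv.subspace W \<and> W \<subseteq> E) \<and>
    (\<forall>W\<in>\<Delta>. \<forall>U. fv.subspace U \<and> U \<subseteq> W \<longrightarrow> U \<in> \<Delta>)"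

definition facets :: "(nat \<Rightarrow> 'k::field) set set \<Rightarrow> (nat \<Rightarrow> 'k) set set"
  where "facets \<Delta> = {W \<in> \<Delta>. \<forall>U\<in>\<Delta>. W \<subseteq> U \<longrightarrow> U = W}"

definition complex_dim :: "(nat \<Rightarrow> 'k::field) set set \<Rightarrow> nat"
  where "complex_dim \<Delta> = Max (fv.dim ` \<Delta>)"

definition pure_complex :: "(nat \<Rightarrow> 'k::field) set set \<Rightarrow> bool"
  where "pure_complex \<Delta> \<longleftrightarrow> (\<forall>F\<in>facets \<Delta>. \<forall>G\<in>facets \<Delta>. fv.dim F = fv.dim G)"

definition qgen :: "(nat \<Rightarrow> 'k::field) set set \<Rightarrow> (nat \<Rightarrow> 'k) set set"
  where "qgen A = {U. fv.subspace U \<and> (\<exists>W\<in>A. U \<subseteq> W)}"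

definition shelling ::
    "(nat \<Rightarrow> 'k::field) set set \<Rightarrow> nat \<Rightarrow> (nat \<Rightarrow> (nat \<Rightarrow> 'k) set) \<Rightarrow> bool"
  where "shelling \<Delta> t F \<longleftrightarrow>
    bij_betw F {1..t} (facets \<Delta>) \<and>
    (\<forall>j\<in>{2..t}. \<exists>A. A \<noteq> {} \<and>
       (\<forall>W\<in>A. fv.subspace W \<and> W \<subseteq> F j \<and> fv.dim W + 1 = fv.dim (F j)) \<and>
       qgen {F j} \<inter> qgen (F ` {1..<j}) = qgen A)"

definition punctured :: "(nat \<Rightarrow> 'k::field) set set \<Rightarrow> (nat \<Rightarrow> 'k) set set"
  where "punctured \<Gamma> = \<Gamma> - {{0}}"

definition punctured_sphere :: "(nat \<Rightarrow> 'k::field) set \<Rightarrow> (nat \<Rightarrow> 'k) set set"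
  where "punctured_sphere V = {U. fv.subspace U \<and> U \<subseteq> V \<and> U \<noteq> {0} \<and> U \<noteq> V}"


subsection \<open>The topology of down-sets and reduced homology\<close>

definition downset_topology :: "'a set set \<Rightarrow> 'a set topology"
  where "downset_topology P = topology (\<lambda>\<U>. \<U> \<subseteq> P \<and> (\<forall>U\<in>\<U>. \<forall>W\<in>P. W \<subseteq> U \<longrightarrow> W \<in> \<U>))"

lemma openin_downset_topology:
  "openin (downset_topology P) \<U> \<longleftrightarrow> \<U> \<subseteq> P \<and> (\<forall>U\<in>\<U>. \<forall>W\<in>P. W \<subseteq> U \<longrightarrow> W \<in> \<U>)"
proof -
  have "istopology (\<lambda>\<U>. \<U> \<subseteq> P \<and> (\<forall>U\<in>\<U>. \<forall>W\<in>P. W \<subseteq> U \<longrightarrow> W \<in> \<U>))"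
    unfolding istopology_def by blast
  then show ?thesis
    by (simp add: downset_topology_def topology_inverse')
qed

lemma topspace_downset_topology [simp]: "topspace (downset_topology P) = P"
  by (auto simp: topspace_def openin_downset_topology)

text \<open>In the library the empty space is contractible; here a contractible space is nonempty.\<close>

definition contractible_poset :: "'a set set \<Rightarrow> bool"
  where "contractible_poset P \<longleftrightarrow> P \<noteq> {} \<and> contractible_space (downset_topology P)"

text \<open>
  The library's reduced homology is trivial in degree \<open>-1\<close> for every space. For the empty space
  we take instead the group in degree \<open>-1\<close> of the augmented singular complex: the free abelian
  group on the only map from the empty simplex, which as an extensional function is
  \<open>\<lambda>_. undefined\<close>. The quotient by the trivial subgroup of boundaries makes the type agree with
  that of the other homology groups.
\<close>

definition red_homology :: "int \<Rightarrow> 'a topology \<Rightarrow> 'a chain set monoid"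
  where "red_homology p X =
    (if topspace X = {} \<and> p = -1
     then free_Abelian_group {\<lambda>_. undefined} Mod {0}
     else reduced_homology_group p X)"

lemma red_homology_empty:
  assumes "topspace X = {}"
  shows "red_homology (-1) X \<cong> integer_group"
proof -
  let ?Z = "free_Abelian_group {\<lambda>_. undefined} :: 'a chain monoid"
  have "group_hom ?Z ?Z id"
    by (simp add: group_hom_def group_hom_axioms_def hom_def)
  moreover have "kernel ?Z ?Z id = {0}"
    by (auto simp: kernel_def free_Abelian_group_def)
  ultimately have "?Z Mod {0} \<cong> ?Z"
    using group_hom.FactGroup_iso[of ?Z ?Z id] by simp
  also have "?Z \<cong> integer_group"
    using group.iso_sym[OF group_integer_group isomorphic_group_integer_free_Abelian_group_singleton] .
  finally (iso_trans) show ?thesis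
    using assms by (simp add: red_homology_def)
qed

end

theory Submission
  imports Defs
begin

text \<open>
  Every nonzero proper subspace of a facet \<open>F i\<close> with \<open>i > l\<close> already lies in the contractible
  part generated by \<open>F 1, \<dots>, F l\<close>: it is contained in an earlier facet, properly so, and one
  descends. Hence the punctured complex arises from a contractible down-set by adding \<open>t - l\<close>
  maximal elements whose lower links, the punctured spheres, lie in that down-set. Each such
  element contributes the homology of its closed down-set, a cone, relative to its link, that is,
  the homology of the link shifted by one degree. The same statement computes the homology of a
  punctured sphere by induction on the dimension and shows that it is concentrated in degree
  \<open>d - 2\<close>.
\<close>

section \<open>Direct products and direct sums of groups\<close>

text \<open>Since \<open>g \<circ> s\<close> is an isomorphism, the image of \<open>s\<close> is a
  complement of the kernel of \<open>g\<close>; commutativity of \<open>B\<close> makes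
  \<open>(a, c) \<mapsto> f a \<otimes> s c\<close> a homomorphism. The group \<open>D\<close> is
  kept apart from \<open>C\<close> because the splitting will start from the homology of an excised
  pair, which is only isomorphic to \<open>C\<close>.\<close>

lemma iso_DirProd_split:
  assumes "comm_group B" and "group A" "group C" "group D"
    and f: "f \<in> hom A B" and inj: "inj_on f (carrier A)"
    and g: "g \<in> hom B C" and ker: "kernel B C g = f ` carrier A"
    and s: "s \<in> hom D B" and iso: "(g \<circ> s) \<in> iso D C"
  shows "A \<times>\<times> D \<cong> B"
proof -
  interpret B: comm_group B by fact
  interpret A: group A by fact
  interpret D: group D by fact
  interpret f: group_hom A B f
    using f by unfold_locales
  interpret s: group_hom D B s
    using s by unfold_locales
  note split = group_semidirect_sum_ker_image[OF iso s g D.is_group B.is_group \<open>group C\<close>, unfolded ker]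
  let ?h = "\<lambda>(a, c). f a \<otimes>\<^bsub>B\<^esub> s c"
  interpret P: group "A \<times>\<times> D"
    by (rule DirProd_group) unfold_locales
  have "?h \<in> hom (A \<times>\<times> D) B"
    by (intro homI) (auto simp: B.m_ac)
  then interpret h: group_hom "A \<times>\<times> D" B ?h
    by unfold_locales
  have sinj: "inj_on s (carrier D)"
    using iso inj_on_imageI2 by (auto simp: iso_def bij_betw_def)
  have "inj_on ?h (carrier (A \<times>\<times> D))"
  proof (subst h.inj_on_one_iff, clarsimp)
    fix a c assume ac: "a \<in> carrier A" "c \<in> carrier D" and 1: "f a \<otimes>\<^bsub>B\<^esub> s c = \<one>\<^bsub>B\<^esub>"
    then have "f a = s (inv\<^bsub>D\<^esub> c)"
      by (simp add: B.inv_equality[symmetric])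
    then have "f a \<in> f ` carrier A \<inter> s ` carrier D"
      using ac D.inv_closed by blast
    then have "f a = \<one>\<^bsub>B\<^esub>"
      using split(1) by blast
    moreover from this have "s c = \<one>\<^bsub>B\<^esub>"
      using 1 ac by simp
    ultimately show "a = \<one>\<^bsub>A\<^esub> \<and> c = \<one>\<^bsub>D\<^esub>"
      using ac inj sinj f.hom_one s.hom_one unfolding inj_on_def by auto
  qed
  moreover have "?h ` carrier (A \<times>\<times> D) = carrier B"
    unfolding split(2)[symmetric] set_mult_def by auto
  ultimately have "?h \<in> iso (A \<times>\<times> D) B"
    using h.homh by (simp add: iso_def bij_betw_def)
  then show ?thesis
    by (rule is_isoI)
qed

lemma sum_group_lessThan_Suc:
  fixes G :: "nat \<Rightarrow> ('a, 'b) monoid_scheme"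
  assumes "\<And>i. i < Suc n \<Longrightarrow> group (G i)"
  shows "sum_group {..<n} G \<times>\<times> G n \<cong> sum_group {..<Suc n} G"
proof -
  \<comment> \<open>Over a finite index set the finite support condition of \<open>sum_group\<close>
    is void, so the carrier is the full extensional product. The bound on \<open>k\<close> covers
    both \<open>n\<close> and \<open>Suc n\<close>.\<close>
  have carr: "carrier (sum_group {..<k} G) = (\<Pi>\<^sub>E i\<in>{..<k}. carrier (G i))" if "k \<le> Suc n" for k
    using that assms by (subst carrier_sum_group) auto
  define h where "h = (\<lambda>(x :: nat \<Rightarrow> 'a, c). \<lambda>i\<in>{..<Suc n}. if i = n then c else x i)"
  have closed: "h (x, c) \<in> carrier (sum_group {..<Suc n} G)"
    if "x \<in> carrier (sum_group {..<n} G)" "c \<in> carrier (G n)" for x c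
    using that unfolding h_def by (simp add: carr PiE_iff)
  have mult: "h (y \<otimes>\<^bsub>sum_group {..<n} G \<times>\<times> G n\<^esub> z) = h y \<otimes>\<^bsub>sum_group {..<Suc n} G\<^esub> h z" for y z
    by (cases y; cases z) (simp add: h_def fun_eq_iff)
  have "h \<in> hom (sum_group {..<n} G \<times>\<times> G n) (sum_group {..<Suc n} G)"
    by (rule homI) (use closed mult in auto)
  moreover have "bij_betw h (carrier (sum_group {..<n} G \<times>\<times> G n)) (carrier (sum_group {..<Suc n} G))"
  proof (rule bij_betw_byWitness[where f' = "\<lambda>y. (restrict y {..<n}, y n)"])
    have "restrict (h (x, c)) {..<n} = x" if "x \<in> (\<Pi>\<^sub>E i\<in>{..<n}. carrier (G i))" for x c
    proof
      show "restrict (h (x, c)) {..<n} i = x i" for i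
        using PiE_arb[OF that, of i] by (auto simp: h_def)
    qed
    moreover have "h (x, c) n = c" for x c
      by (simp add: h_def)
    ultimately show "\<forall>a\<in>carrier (sum_group {..<n} G \<times>\<times> G n). (restrict (h a) {..<n}, h a n) = a"
      by (simp add: carr)
    show "\<forall>y\<in>carrier (sum_group {..<Suc n} G). h (restrict y {..<n}, y n) = y"
      by (simp add: h_def carr PiE_iff fun_eq_iff extensional_def less_Suc_eq)
    show "h ` carrier (sum_group {..<n} G \<times>\<times> G n) \<subseteq> carrier (sum_group {..<Suc n} G)"
      using closed by auto
    show "(\<lambda>y. (restrict y {..<n}, y n)) ` carrier (sum_group {..<Suc n} G) \<subseteq> carrier (sum_group {..<n} G \<times>\<times> G n)"
      by (simp add: carr PiE_iff image_subset_iff)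
  qed
  ultimately show ?thesis
    by (intro is_isoI) (simp add: iso_def)
qed

lemma trivial_sum_group:
  assumes "\<And>i. i \<in> I \<Longrightarrow> trivial_group (G i)"
  shows "trivial_group (sum_group I G)"
proof -
  have G: "\<And>i. i \<in> I \<Longrightarrow> group (G i)"
    using assms trivial_group_def by blast
  then have "carrier (sum_group I G) \<subseteq> {\<lambda>i\<in>I. \<one>\<^bsub>G i\<^esub>}"
    using assms by (auto simp: carrier_sum_group[OF G] trivial_group_def PiE_iff extensional_def fun_eq_iff)
  then show ?thesis
    using group.trivial_group_alt[OF sum_group[of I G]] G by auto
qed

lemma iso_trivial_groups:
  assumes "trivial_group G" "trivial_group H"
  shows "G \<cong> H"
  using assms
  by (intro is_isoI[of "\<lambda>_. \<one>\<^bsub>H\<^esub>"]) (auto simp: trivial_group_def iso_def bij_betw_def hom_def group.is_monoid monoid.l_one)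

section \<open>Splitting the homology of a space covered by two open sets\<close>

lemma comm_group_reduced_homology_group: "comm_group (reduced_homology_group p X)"
  unfolding reduced_homology_group_def
  by (intro group.abelian_subgroup_generated) (simp_all add: abelian_homology_group)

text \<open>
  The split needs no freeness: since \<open>Q\<close> is contractible, the inclusion of \<open>(Y, A \<inter> Y)\<close> into
  \<open>(X, Q)\<close> lifts to the reduced homology of \<open>X\<close>, and composing with the map to the pair
  \<open>(X, A)\<close> gives the excision isomorphism.
\<close>

lemma reduced_homology_attach:
  assumes A: "openin X A" and Y: "openin X Y" and cover: "A \<union> Y = topspace X"
    and Q: "Q \<subseteq> A" "Q \<noteq> {}" "contractible_space (subtopology X Q)" and AY: "A \<inter> Y \<subseteq> Q"
  shows "reduced_homology_group p (subtopology X A) \<times>\<times> relative_homology_group p (subtopology X Y) (A \<inter> Y)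
    \<cong> reduced_homology_group p X"
proof -
  have subs: "A \<subseteq> topspace X" "Y \<subseteq> topspace X"
    using A Y openin_subset by auto
  have ne: "topspace X \<inter> A \<noteq> {}" "topspace X \<inter> Q \<noteq> {}"
    using subs Q by auto
  let ?j = "\<lambda>p. hom_induced p X {} X A id"
  let ?jQ = "\<lambda>p. hom_induced p X {} X Q id"
  let ?i = "hom_induced p (subtopology X A) {} X {} id"
  let ?u = "\<lambda>p. hom_induced p (subtopology X Y) (A \<inter> Y) X Q id"
  let ?s = "\<lambda>p. inv_into (carrier (reduced_homology_group p X)) (?jQ p) \<circ> ?u p"
  have jQ: "?jQ p \<in> iso (reduced_homology_group p X) (relative_homology_group p X Q)" for p
    using iso_reduced_homology_by_contractible[OF Q(3) ne(2)] .
  have inv_jQ: "inv_into (carrier (reduced_homology_group p X)) (?jQ p)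
      \<in> hom (relative_homology_group p X Q) (reduced_homology_group p X)" for p
    using group.iso_set_sym[OF group_reduced_homology_group jQ] by (simp add: iso_def)
  have s: "?s p \<in> hom (relative_homology_group p (subtopology X Y) (A \<inter> Y)) (reduced_homology_group p X)" for p
    using hom_compose[OF hom_induced_hom inv_jQ] .
  \<comment> \<open>The excised set is the complement of \<open>Y\<close>: it is closed, and by
    \<open>cover\<close> it lies in the open set \<open>A\<close>.\<close>
  have excise: "hom_induced p (subtopology X Y) (A \<inter> Y) X A id
      \<in> iso (relative_homology_group p (subtopology X Y) (A \<inter> Y)) (relative_homology_group p X A)" for p
  proof -
    have "X closure_of (topspace X - Y) \<subseteq> X interior_of A"
      using A Y cover by (subst closure_of_eq[THEN iffD2]) (auto simp: interior_of_openin)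
    moreover have YA: "A - (topspace X - Y) = A \<inter> Y"
      using subs by auto
    ultimately show ?thesis
      using homology_excision_axiom[of X "topspace X - Y" A "topspace X" p] subs
      by (simp add: double_diff YA)
  qed
  \<comment> \<open>The map \<open>?j\<close> factors through the pair \<open>(X, Q)\<close>, where
    \<open>?s\<close> undoes \<open>?jQ\<close>; so \<open>?j \<circ> ?s\<close> is induced by the
    inclusion of \<open>(Y, A \<inter> Y)\<close> into \<open>(X, A)\<close>.\<close>
  have "(?j p \<circ> ?s p) c = hom_induced p (subtopology X Y) (A \<inter> Y) X A id c"
    if "c \<in> carrier (relative_homology_group p (subtopology X Y) (A \<inter> Y))" for p c
  proof -
    have "?j p = hom_induced p X Q X A id \<circ> ?jQ p"
      using Q by (subst hom_induced_compose[symmetric]) auto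
    moreover have "?jQ p (?s p c) = ?u p c"
      using jQ[of p] hom_induced_carrier[of p "subtopology X Y" "A \<inter> Y" X Q id c]
      by (simp add: iso_def bij_betw_def f_inv_into_f)
    ultimately have "(?j p \<circ> ?s p) c = (hom_induced p X Q X A id \<circ> ?u p) c"
      by simp
    also have "hom_induced p X Q X A id \<circ> ?u p = hom_induced p (subtopology X Y) (A \<inter> Y) X A id"
      using Q AY by (subst hom_induced_compose[symmetric]) (auto simp: continuous_map_from_subtopology)
    finally show ?thesis .
  qed
  then have js: "(?j p \<circ> ?s p) \<in> iso (relative_homology_group p (subtopology X Y) (A \<inter> Y)) (relative_homology_group p X A)" for p
    using group.iso_eq[OF group_relative_homology_group excise] by force
  have jsurj: "?j p ` carrier (reduced_homology_group p X) = carrier (relative_homology_group p X A)" for p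
  proof
    show "?j p ` carrier (reduced_homology_group p X) \<subseteq> carrier (relative_homology_group p X A)"
      using hom_induced_carrier by blast
    have "carrier (relative_homology_group p X A) = ?j p ` ?s p ` carrier (relative_homology_group p (subtopology X Y) (A \<inter> Y))"
      using js[of p] unfolding iso_def bij_betw_def image_comp by blast
    also have "\<dots> \<subseteq> ?j p ` carrier (reduced_homology_group p X)"
      using s[of p] by (intro image_mono) (auto simp: hom_def)
    finally show "carrier (relative_homology_group p X A) \<subseteq> ?j p ` carrier (reduced_homology_group p X)" .
  qed
  \<comment> \<open>Surjectivity of \<open>?j\<close> in degree \<open>p + 1\<close> makes the
    boundary map vanish, and exactness turns this into injectivity of \<open>?i\<close> in degree
    \<open>p\<close>.\<close>
  have inj: "inj_on ?i (carrier (reduced_homology_group p (subtopology X A)))"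
  proof -
    let ?b = "hom_boundary (p + 1) X A"
    have "kernel (relative_homology_group (p + 1) X A) (reduced_homology_group p (subtopology X A)) ?b
        = carrier (relative_homology_group (p + 1) X A)"
      using homology_exactness_reduced_1[OF ne(1), of "p + 1"] jsurj[of "p + 1"] by simp
    then have "?b ` carrier (relative_homology_group (p + 1) X A) \<subseteq> {\<one>\<^bsub>reduced_homology_group p (subtopology X A)\<^esub>}"
      unfolding kernel_def by blast
    moreover have "kernel (reduced_homology_group p (subtopology X A)) (reduced_homology_group p X) ?i
        = ?b ` carrier (relative_homology_group (p + 1) X A)"
      using homology_exactness_reduced_2[of "p + 1" X A] by simp
    ultimately have ker: "kernel (reduced_homology_group p (subtopology X A)) (reduced_homology_group p X) ?i
        \<subseteq> {\<one>\<^bsub>reduced_homology_group p (subtopology X A)\<^esub>}"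
      by (simp only:)
    interpret i: group_hom "reduced_homology_group p (subtopology X A)" "reduced_homology_group p X" ?i
      by (simp add: group_hom_def group_hom_axioms_def hom_induced_reduced_hom)
    show ?thesis
      using ker subgroup.one_closed[OF i.subgroup_kernel] by (intro i.trivial_ker_imp_inj) blast
  qed
  show ?thesis
  proof (rule iso_DirProd_split)
    show "kernel (reduced_homology_group p X) (relative_homology_group p X A) (?j p)
       = ?i ` carrier (reduced_homology_group p (subtopology X A))"
      and "?j p \<in> hom (reduced_homology_group p X) (relative_homology_group p X A)"
      using homology_exactness_reduced_3[of p X A] by (simp_all add: group_hom_def group_hom_axioms_def)
  qed (fact comm_group_reduced_homology_group group_reduced_homology_group group_relative_homology_group
        hom_induced_reduced_hom inj s js)+
qed

section \<open>Down-set topologies and contractions from order relations\<close>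

text \<open>A down-set of \<open>P \<inter> S\<close> is the trace on \<open>S\<close> of its
  down-closure in \<open>P\<close>.\<close>

lemma subtopology_downset_topology:
  "subtopology (downset_topology P) S = downset_topology (P \<inter> S)"
proof (rule topology_eq[THEN iffD2], intro allI)
  fix D
  show "openin (subtopology (downset_topology P) S) D \<longleftrightarrow> openin (downset_topology (P \<inter> S)) D"
  proof
    assume D: "openin (downset_topology (P \<inter> S)) D"
    then have "D = {W \<in> P. \<exists>U\<in>D. W \<subseteq> U} \<inter> S"
      by (auto simp: openin_downset_topology)
    moreover have "openin (downset_topology P) {W \<in> P. \<exists>U\<in>D. W \<subseteq> U}"
      by (auto simp: openin_downset_topology)
    ultimately show "openin (subtopology (downset_topology P) S) D"
      unfolding openin_subtopology by blast
  qed (auto simp: openin_subtopology openin_downset_topology)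
qed

lemma continuous_map_downset_topology:
  assumes "\<And>U. U \<in> P \<Longrightarrow> f U \<in> R" and "\<And>U W. U \<in> P \<Longrightarrow> W \<in> P \<Longrightarrow> U \<subseteq> W \<Longrightarrow> f U \<subseteq> f W"
  shows "continuous_map (downset_topology P) (downset_topology R) f"
  using assms unfolding continuous_map_def
  by (fastforce simp: openin_downset_topology)

text \<open>The homotopy stays at \<open>f\<close> and jumps to \<open>g\<close> at time 1. This is
  continuous because \<open>g x \<in> D\<close> implies \<open>f x \<in> D\<close> for a down-set
  \<open>D\<close>, so the preimage of \<open>D\<close> is the union of two open boxes, over
  \<open>{0..<1}\<close> and over \<open>{0..1}\<close>. The jump has to go upwards at the closed
  end.\<close>

lemma homotopic_with_downset_topology:
  assumes f: "continuous_map X (downset_topology R) f" and g: "continuous_map X (downset_topology R) g"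
    and le: "\<And>x. x \<in> topspace X \<Longrightarrow> f x \<subseteq> g x"
  shows "homotopic_with (\<lambda>_. True) X (downset_topology R) f g"
proof -
  let ?I = "top_of_set {0..1::real}"
  let ?h = "\<lambda>(t, x). if t < (1::real) then f x else g x"
  have "continuous_map (prod_topology ?I X) (downset_topology R) ?h"
    unfolding continuous_map_def
  proof (intro conjI allI impI)
    show "?h \<in> topspace (prod_topology ?I X) \<rightarrow> topspace (downset_topology R)"
      using f g by (auto simp: continuous_map_def)
    fix D assume D: "openin (downset_topology R) D"
    have down: "f x \<in> D" if "x \<in> topspace X" "g x \<in> D" for x
    proof -
      have "f x \<in> R"
        using f that(1) by (auto simp: continuous_map_def)
      with D le[OF that(1)] that(2) show ?thesis
        by (auto simp: openin_downset_topology)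
    qed
    have "{z \<in> topspace (prod_topology ?I X). ?h z \<in> D}
      = {0..<1} \<times> {x \<in> topspace X. f x \<in> D} \<union> {0..1} \<times> {x \<in> topspace X. g x \<in> D}"
      using down by (auto split: if_splits)
    moreover have "openin ?I {0..<1}"
      unfolding openin_open by (rule exI[of _ "{..<1}"]) auto
    moreover have "openin ?I {0..1}"
      by simp
    moreover have "openin X {x \<in> topspace X. f x \<in> D}" "openin X {x \<in> topspace X. g x \<in> D}"
      using f g D by (auto simp: continuous_map_def)
    ultimately show "openin (prod_topology ?I X) {z \<in> topspace (prod_topology ?I X). ?h z \<in> D}"
      by (simp add: openin_Un openin_prod_Times_iff)
  qed
  then show ?thesis
    unfolding homotopic_with_def by (intro exI[of _ ?h]) auto
qed

text \<open>The identity lies below \<open>k\<close>, and so does the constant map to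
  \<open>c\<close>; comparable monotone maps are homotopic, so the identity is homotopic to a
  constant.\<close>

lemma contractible_poset_conical:
  assumes c: "c \<in> P" and im: "\<And>U. U \<in> P \<Longrightarrow> k U \<in> P"
    and mono: "\<And>U W. U \<in> P \<Longrightarrow> W \<in> P \<Longrightarrow> U \<subseteq> W \<Longrightarrow> k U \<subseteq> k W"
    and "\<And>U. U \<in> P \<Longrightarrow> U \<subseteq> k U" and "\<And>U. U \<in> P \<Longrightarrow> c \<subseteq> k U"
  shows "contractible_poset P"
proof -
  let ?X = "downset_topology P"
  have "homotopic_with (\<lambda>_. True) ?X ?X id k"
    using assms by (intro homotopic_with_downset_topology continuous_map_downset_topology) auto
  moreover have "homotopic_with (\<lambda>_. True) ?X ?X (\<lambda>_. c) k"
    using assms by (intro homotopic_with_downset_topology continuous_map_downset_topology) auto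
  ultimately have "homotopic_with (\<lambda>_. True) ?X ?X id (\<lambda>_. c)"
    using homotopic_with_trans homotopic_with_sym by blast
  then show ?thesis
    using c unfolding contractible_poset_def contractible_space_def by blast
qed

section \<open>Reduced homology and cones over links\<close>

lemma group_red_homology [simp]: "group (red_homology p X)"
proof -
  have "group (free_Abelian_group {\<lambda>_. undefined} Mod {0 :: 'a chain})"
  proof (rule normal.factorgroup_is_group)
    interpret comm_group "free_Abelian_group {\<lambda>_. undefined} :: 'a chain monoid"
      by (rule abelian_free_Abelian_group)
    show "{0} \<lhd> (free_Abelian_group {\<lambda>_. undefined} :: 'a chain monoid)"
      using one_is_normal by simp
  qed
  then show ?thesis
    by (simp add: red_homology_def)
qed

lemma red_homology_nonempty:
  "topspace X \<noteq> {} \<Longrightarrow> red_homology p X = reduced_homology_group p X"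
  by (simp add: red_homology_def)

lemma red_homology_homeomorphic:
  fixes X Y :: "'a topology"
  assumes "X homeomorphic_space Y"
  shows "red_homology p X \<cong> red_homology p Y"
  using assms homeomorphic_empty_space[OF assms]
  by (auto simp: red_homology_def iso_refl homeomorphic_space_imp_isomorphic_reduced_homology_groups)

text \<open>The top element \<open>m\<close> makes \<open>insert m S\<close> a cone, hence
  contractible, and the long exact sequence of the pair shifts the homology of the link by one
  degree.\<close>

lemma relative_homology_closed_cone:
  assumes m: "m \<notin> S" "\<And>U. U \<in> S \<Longrightarrow> U \<subseteq> m"
  shows "relative_homology_group p (downset_topology (insert m S)) S \<cong> red_homology (p - 1) (downset_topology S)"
proof -
  let ?Y = "downset_topology (insert m S)"
  have "contractible_poset (insert m S)"
    using m by (intro contractible_poset_conical[where c = m and k = "\<lambda>_. m"]) auto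
  then have cY: "contractible_space ?Y"
    by (simp add: contractible_poset_def)
  show ?thesis
  proof (cases "S = {}")
    case False
    have "relative_homology_group p ?Y S \<cong> reduced_homology_group (p - 1) (subtopology ?Y S)"
      using False by (intro isomorphic_group_relative_homology_of_contractible cY) auto
    also have "subtopology ?Y S = downset_topology S"
      by (simp add: subtopology_downset_topology inf.absorb2 subset_insertI)
    finally show ?thesis
      using False by (simp add: red_homology_nonempty)
  next
    \<comment> \<open>For an empty link the pair is a point relative to the empty set. Its integers
      in degree 0 match degree -1 of the empty space under the convention in
      \<open>red_homology\<close>; all other degrees are trivial on both sides.\<close>
    case True
    then have top: "topspace ?Y = {m}" by simp
    show ?thesis
    proof (cases "p = 0")
      case True
      have "homology_group 0 ?Y \<cong> integer_group"
        using cY \<open>S = {}\<close>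
        by (intro isomorphic_integer_zeroth_homology_group contractible_imp_path_connected_space) auto
      also have "integer_group \<cong> red_homology (-1) (downset_topology S)"
        using \<open>S = {}\<close> by (intro group.iso_sym[OF group_red_homology red_homology_empty]) simp
      finally show ?thesis
        using True \<open>S = {}\<close> by simp
    next
      case False
      have "trivial_group (red_homology (p - 1) (downset_topology S))"
        using False \<open>S = {}\<close> by (simp add: red_homology_def trivial_reduced_homology_group_empty)
      with False show ?thesis
        using homology_dimension_axiom[OF top False] \<open>S = {}\<close> by (simp add: iso_trivial_groups)
    qed
  qed
qed

section \<open>Attaching maximal elements to a contractible poset\<close>

text \<open>Elements of \<open>M\<close> are attached one at a time. They are pairwise incomparable,
  so the closed down-set of a new \<open>m\<close> meets the earlier part exactly in its link inside
  \<open>Q\<close>, and the same \<open>Q\<close> serves in every application of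
  \<open>reduced_homology_attach\<close>. The group \<open>G\<close> is a common model for the
  homology of all links.\<close>

lemma reduced_homology_attach_facets:
  assumes "finite M" and "group G" and Q: "contractible_poset Q" and "Q \<inter> M = {}"
    and "\<And>m U. m \<in> M \<Longrightarrow> U \<in> Q \<Longrightarrow> \<not> m \<subseteq> U"
    and "\<And>m U. m \<in> M \<Longrightarrow> U \<in> M \<Longrightarrow> U \<subseteq> m \<Longrightarrow> U = m"
    and "\<And>m. m \<in> M \<Longrightarrow> red_homology (p - 1) (downset_topology {U \<in> Q. U \<subseteq> m}) \<cong> G"
  shows "reduced_homology_group p (downset_topology (Q \<union> M)) \<cong> sum_group {..<card M} (\<lambda>_. G)"
  using assms(1,4-7)
proof (induction M)
  case empty
  have "trivial_group (reduced_homology_group p (downset_topology Q))"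
    using Q by (simp add: contractible_poset_def trivial_reduced_homology_group_contractible_space)
  then show ?case
    using iso_trivial_groups[OF _ trivial_sum_group[of "{}"]] by simp
next
  case (insert m M)
  let ?X = "downset_topology (Q \<union> insert m M)" and ?S = "{U \<in> Q. U \<subseteq> m}"
  have "reduced_homology_group p (subtopology ?X (Q \<union> M)) \<times>\<times>
      relative_homology_group p (subtopology ?X (insert m ?S)) ((Q \<union> M) \<inter> insert m ?S)
    \<cong> reduced_homology_group p ?X"
  proof (rule reduced_homology_attach)
    \<comment> \<open>Nothing else lies above \<open>m\<close>, so a down-set remains when
      \<open>m\<close> is removed.\<close>
    have "\<not> m \<subseteq> U" if "U \<in> Q \<union> M" for U
      using that insert.prems(2)[of m U] insert.prems(3)[of U m] insert.hyps(2) by auto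
    then show "openin ?X (Q \<union> M)"
      unfolding openin_downset_topology by blast
    have "W \<in> insert m ?S" if "U \<in> insert m ?S" "W \<in> Q \<union> insert m M" "W \<subseteq> U" for U W
      using that insert.prems(2)[of W U] insert.prems(3)[of m W] by auto
    then show "openin ?X (insert m ?S)"
      unfolding openin_downset_topology by blast
    show "contractible_space (subtopology ?X Q)" "Q \<noteq> {}"
      using Q by (simp_all add: contractible_poset_def subtopology_downset_topology Int_absorb1 subset_insertI2)
    show "(Q \<union> M) \<inter> insert m ?S \<subseteq> Q"
      using insert.hyps by auto
  qed auto
  moreover have "(Q \<union> insert m M) \<inter> (Q \<union> M) = Q \<union> M" "(Q \<union> M) \<inter> insert m ?S = ?S"
    "(Q \<union> insert m M) \<inter> insert m ?S = insert m ?S"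
    using insert.hyps insert.prems(1) by auto
  ultimately have "reduced_homology_group p (downset_topology (Q \<union> M)) \<times>\<times>
      relative_homology_group p (downset_topology (insert m ?S)) ?S \<cong> reduced_homology_group p ?X"
    by (simp only: subtopology_downset_topology)
  then have "reduced_homology_group p ?X \<cong> reduced_homology_group p (downset_topology (Q \<union> M)) \<times>\<times>
      relative_homology_group p (downset_topology (insert m ?S)) ?S"
    by (rule group.iso_sym[rotated]) (simp add: DirProd_group)
  also have "\<dots> \<cong> sum_group {..<card M} (\<lambda>_. G) \<times>\<times> G"
  proof (rule group.DirProd_iso_trans)
    show "reduced_homology_group p (downset_topology (Q \<union> M)) \<cong> sum_group {..<card M} (\<lambda>_. G)"
      by (rule insert.IH) (use insert.prems in blast)+
    have "relative_homology_group p (downset_topology (insert m ?S)) ?S \<cong> red_homology (p - 1) (downset_topology ?S)"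
      using insert.prems(1) by (intro relative_homology_closed_cone) auto
    also have "\<dots> \<cong> G"
      by (rule insert.prems) simp
    finally show "relative_homology_group p (downset_topology (insert m ?S)) ?S \<cong> G" .
  qed simp
  also have "\<dots> \<cong> sum_group {..<card (insert m M)} (\<lambda>_. G)"
    using sum_group_lessThan_Suc[of "card M" "\<lambda>_. G"] insert.hyps \<open>group G\<close> by simp
  finally show ?case .
qed

section \<open>Finite subspaces and their dimension\<close>

lemma finite_coord_space: "finite (coord_space n :: (nat \<Rightarrow> 'k :: {field, finite}) set)"
proof -
  have "coord_space n = {v :: nat \<Rightarrow> 'k. \<forall>i. (i \<in> {..<n} \<longrightarrow> v i \<in> UNIV) \<and> (i \<notin> {..<n} \<longrightarrow> v i = 0)}"
    by (auto simp: coord_space_def)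
  then show ?thesis
    using finite_set_of_finite_funs[of "{..<n}" "UNIV :: 'k set" 0] by simp
qed

text \<open>A finite basis of \<open>W\<close> also spans \<open>U\<close>. Finiteness of the sets
  takes the place of a finite-dimensional ambient space, since the space of all functions is
  infinite-dimensional.\<close>

lemma dim_mono_finite:
  assumes "U \<subseteq> W" "finite W"
  shows "fv.dim U \<le> fv.dim W"
proof -
  obtain B where B: "B \<subseteq> W" "fv.independent B" "W \<subseteq> fv.span B" "card B = fv.dim W"
    using fv.basis_exists by blast
  then show ?thesis
    using assms fv.dim_le_card[of U B] finite_subset[of B W] by simp
qed

lemma dim_span_insert:
  assumes "fv.subspace U" "finite U" "v \<notin> U"
  shows "fv.dim (fv.span (insert v U)) = Suc (fv.dim U)"
proof -
  obtain B where B: "B \<subseteq> U" "fv.independent B" "U \<subseteq> fv.span B" "card B = fv.dim U"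
    using fv.basis_exists by blast
  then have span_B: "fv.span B = U"
    using assms(1) fv.span_subspace by blast
  then have "fv.independent (insert v B)"
    using B assms(3) by (intro fv.independent_insertI) auto
  moreover have "fv.span (insert v U) = fv.span (insert v B)"
    using span_B by (metis fv.span_insert fv.span_span)
  moreover have "v \<notin> B" "finite B"
    using B assms finite_subset by auto
  ultimately show ?thesis
    using B(4) by (simp add: fv.dim_eq_card_independent)
qed

lemma dim_psubset_finite:
  assumes "fv.subspace U" "fv.subspace W" "finite W" "U \<subset> W"
  shows "fv.dim U < fv.dim W"
proof -
  obtain w where w: "w \<in> W" "w \<notin> U"
    using assms(4) by blast
  have "Suc (fv.dim U) = fv.dim (fv.span (insert w U))"
    using assms w by (intro dim_span_insert[symmetric]) (auto intro: finite_subset)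
  also have "\<dots> \<le> fv.dim W"
    using assms w by (intro dim_mono_finite fv.span_minimal) auto
  finally show ?thesis by simp
qed

lemma dim_zero_space: "fv.dim {0 :: nat \<Rightarrow> 'k :: field} = 0"
  using fv.dim_span[of "{} :: (nat \<Rightarrow> 'k) set"] fv.dim_eq_card_independent[OF fv.independent_empty] by simp

lemma dim_pos_finite:
  assumes "fv.subspace U" "finite U" "U \<noteq> {0}"
  shows "0 < fv.dim U"
proof -
  have "{0} \<subset> U"
    using assms fv.subspace_0[of U] by blast
  then show ?thesis
    using dim_psubset_finite[of "{0}" U] assms by simp
qed

lemma dim_coord_space: "fv.dim (coord_space n :: (nat \<Rightarrow> 'k :: {field, finite}) set) = n"
proof (induction n)
  case 0
  have "coord_space 0 = {0 :: nat \<Rightarrow> 'k}"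
    by (auto simp: coord_space_def)
  then show ?case
    by (simp add: dim_zero_space)
next
  case (Suc n)
  \<comment> \<open>The unit vector at index \<open>n\<close>; subtracting \<open>v n\<close> times
    it clears the last coordinate of \<open>v\<close>.\<close>
  define e where "e = (\<lambda>i. if i = n then 1 else 0 :: 'k)"
  have "coord_space (Suc n) = fv.span (insert e (coord_space n))"
  proof -
    have "v \<in> coord_space (Suc n) \<longleftrightarrow> (\<exists>k. v - fscale k e \<in> coord_space n)" for v
    proof
      assume "v \<in> coord_space (Suc n)"
      then have "v - fscale (v n) e \<in> coord_space n"
        by (auto simp: coord_space_def e_def fscale_def)
      then show "\<exists>k. v - fscale k e \<in> coord_space n" ..
    qed (auto simp: coord_space_def e_def fscale_def)
    then show ?thesis
      using subspace_coord_space[where 'k = 'k] by (simp add: fv.span_insert fv.span_eq_iff[THEN iffD2] set_eq_iff)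
  qed
  moreover have "e \<notin> coord_space n"
    by (simp add: coord_space_def e_def)
  ultimately show ?case
    using Suc dim_span_insert[OF subspace_coord_space finite_coord_space] by metis
qed

section \<open>Punctured spheres\<close>

text \<open>A linear isomorphism of \<open>V\<close> onto \<open>W\<close> induces an isomorphism of
  the posets of subspaces, monotone in both directions. It serves to replace every facet by
  \<open>coord_space d\<close>.\<close>

lemma punctured_sphere_homeomorphic:
  fixes V W :: "(nat \<Rightarrow> 'k :: field) set"
  assumes V: "fv.subspace V" "finite V" and W: "fv.subspace W" "finite W"
    and "fv.dim V = fv.dim W"
  shows "downset_topology (punctured_sphere V) homeomorphic_space downset_topology (punctured_sphere W)"
proof -
  interpret vector_space_pair "fscale :: 'k \<Rightarrow> _" "fscale :: 'k \<Rightarrow> _" ..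
  obtain B where B: "B \<subseteq> V" "fv.independent B" "V \<subseteq> fv.span B" "card B = fv.dim V"
    using fv.basis_exists by blast
  obtain C where C: "C \<subseteq> W" "fv.independent C" "W \<subseteq> fv.span C" "card C = fv.dim W"
    using fv.basis_exists by blast
  obtain f where f: "Vector_Spaces.linear fscale fscale f" "f ` V = W" "inj_on f V"
    using finite_basis_to_basis_subspace_isomorphism[OF V(1) W(1) assms(5) finite_subset[OF B(1) V(2)] B
        finite_subset[OF C(1) W(2)] C] by blast
  interpret f: Vector_Spaces.linear fscale fscale f by fact
  have zero: "0 \<in> V" "0 \<in> W"
    using V W fv.subspace_0 by auto
  \<comment> \<open>The map \<open>f\<close> is linear on the whole ambient space but known to be
    injective only on \<open>V\<close>, so preimages are cut down to \<open>V\<close>.\<close>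
  let ?g = "\<lambda>U. V \<inter> f -` U"
  have fg: "f ` ?g U = U" if "U \<subseteq> W" for U
    using f(2) that by blast
  have gf: "?g (f ` U) = U" if "U \<subseteq> V" for U
    using f(3) that by (auto simp: inj_on_def)
  have f0: "f ` {0} = {0}"
    by (simp add: f.zero)
  have fim: "f ` U \<in> punctured_sphere W" if U: "U \<in> punctured_sphere V" for U
  proof -
    have "f ` U \<noteq> f ` {0}" "f ` U \<noteq> f ` V"
      using U zero inj_on_image_eq_iff[OF f(3), of U "{0}"] inj_on_image_eq_iff[OF f(3), of U V]
      by (simp_all add: punctured_sphere_def)
    then show ?thesis
      using U f(2) f0 by (auto simp: punctured_sphere_def f.subspace_image)
  qed
  have gim: "?g U \<in> punctured_sphere V" if U: "U \<in> punctured_sphere W" for U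
  proof -
    have U': "fv.subspace U" "U \<subseteq> W" "U \<noteq> {0}" "U \<noteq> W"
      using U by (auto simp: punctured_sphere_def)
    have "fv.subspace (?g U)"
      using V(1) f.subspace_vimage[OF U'(1)] by (rule fv.subspace_inter)
    moreover have "?g U \<noteq> {0}" "?g U \<noteq> V"
      using fg[OF U'(2)] f0 f(2) U' by metis+
    ultimately show ?thesis
      by (auto simp: punctured_sphere_def)
  qed
  have "homeomorphic_maps (downset_topology (punctured_sphere V)) (downset_topology (punctured_sphere W)) ((`) f) ?g"
    unfolding homeomorphic_maps_def
  proof (intro conjI continuous_map_downset_topology)
    show "\<forall>U\<in>topspace (downset_topology (punctured_sphere V)). ?g (f ` U) = U"
      using gf by (simp add: punctured_sphere_def)
    show "\<forall>U\<in>topspace (downset_topology (punctured_sphere W)). f ` ?g U = U"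
      using fg by (simp add: punctured_sphere_def)
  qed (use fim gim in auto)
  then show ?thesis
    unfolding homeomorphic_space_def by blast
qed

text \<open>
  Fix a nonzero vector \<open>v\<close>. The subspaces that do not span \<open>V\<close> together with \<open>v\<close> contract
  conically via \<open>U \<le> U + \<langle>v\<rangle> \<ge> \<langle>v\<rangle>\<close>; what remains are the hyperplanes avoiding \<open>v\<close>, whose
  lower links are punctured spheres of one dimension less.
\<close>

lemma trivial_red_homology_punctured_sphere:
  assumes "fv.subspace V" "finite V" "fv.dim V = Suc k" "p \<noteq> int k - 1"
  shows "trivial_group (red_homology p (downset_topology (punctured_sphere V)))"
  using assms
proof (induction k arbitrary: V p)
  \<comment> \<open>A one-dimensional space has no nonzero proper subspace, so the poset is empty;
    its only nontrivial group sits in degree -1, which is the excluded value of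
    \<open>p\<close>.\<close>
  case 0
  have "U \<notin> punctured_sphere V" for U
  proof
    assume "U \<in> punctured_sphere V"
    then have U: "fv.subspace U" "U \<subset> V" "U \<noteq> {0}"
      by (auto simp: punctured_sphere_def)
    then show False
      using dim_psubset_finite[of U V] dim_pos_finite[of U] 0 finite_subset[of U V] by auto
  qed
  then have "punctured_sphere V = {}"
    by blast
  then show ?case
    using 0 by (simp add: red_homology_def trivial_reduced_homology_group_empty)
next
  case (Suc k)
  note V = Suc.prems(1-3)
  have "V \<noteq> {0}"
    using V(3) dim_zero_space by (metis nat.distinct(1))
  then obtain v where v: "v \<in> V" "v \<noteq> 0"
    using V(1) fv.subspace_0 by blast
  let ?k = "\<lambda>U. fv.span (insert v U)"
  let ?S = "punctured_sphere V"
  define Q where "Q = {U \<in> ?S. ?k U \<noteq> V}"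
  define M where "M = {U \<in> ?S. ?k U = V}"
  have S: "fv.subspace U" "U \<subseteq> V" "U \<noteq> {0}" "U \<noteq> V" "finite U" if "U \<in> ?S" for U
    using that V(2) finite_subset by (auto simp: punctured_sphere_def)
  have sup: "insert v U \<subseteq> ?k U" for U
    by (rule fv.span_superset)
  have kV: "?k U \<subseteq> V" if "U \<subseteq> V" for U
    using that v V(1) by (intro fv.span_minimal) auto
  have kk: "?k (?k U) = ?k U" for U
    using sup[of U] by (metis fv.span_span insert_absorb insert_subset)
  have k_mono: "?k U \<subseteq> ?k W" if "U \<subseteq> W" for U W
    using that by (intro fv.span_mono) auto
  \<comment> \<open>The line spanned by \<open>v\<close> is the apex of the contraction; it differs
    from \<open>V\<close> because \<open>V\<close> has dimension at least 2.\<close>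
  have line: "?k {} \<in> Q"
  proof -
    have "fv.dim (?k {}) \<le> 1"
      using fv.dim_le_card[of "?k {}" "{v}"] by simp
    then have "?k {} \<noteq> V"
      using V(3) by auto
    then show ?thesis
      using v sup[of "{}"] kV[of "{}"] kk[of "{}"] by (auto simp: Q_def punctured_sphere_def)
  qed
  have Q: "contractible_poset Q"
  proof (rule contractible_poset_conical[where k = ?k, OF line])
    show "?k U \<in> Q" if "U \<in> Q" for U
      using that v sup[of U] kV[of U] kk[of U] by (auto simp: Q_def punctured_sphere_def)
    show "U \<subseteq> ?k U" for U
      using sup by blast
  qed (use k_mono in simp_all)
  have notin: "v \<notin> m" if "m \<in> M" for m
  proof
    assume "v \<in> m"
    then have "?k m = m"
      using that S(1)[of m] by (simp add: M_def insert_absorb fv.span_eq_iff[THEN iffD2])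
    then show False
      using that S(4)[of m] unfolding M_def by blast
  qed
  \<comment> \<open>Any \<open>x\<close> in \<open>m\<close> is \<open>u + c v\<close> with
    \<open>u\<close> in \<open>U\<close>; then \<open>c v\<close> lies in \<open>m\<close>, which
    avoids \<open>v\<close>, so \<open>c = 0\<close> and \<open>x\<close> lies in
    \<open>U\<close>.\<close>
  have max: "U = m" if "m \<in> M" "U \<in> M" "U \<subseteq> m" for U m
  proof -
    have m: "fv.subspace m" and span_U: "fv.span U = U"
      using that S(1) by (auto simp: M_def)
    have "m \<subseteq> U"
    proof
      fix x assume "x \<in> m"
      then have "x \<in> ?k U"
        using that S(2)[of m] unfolding M_def by blast
      then obtain c where c: "x - fscale c v \<in> U"
        using span_U by (auto simp: fv.span_insert)
      then have "fscale c v \<in> m"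
        using \<open>U \<subseteq> m\<close> \<open>x \<in> m\<close> m fv.subspace_diff[of m x "x - fscale c v"] by auto
      then have "c = 0"
        using notin[OF that(1)] fv.subspace_scale[OF m, of "fscale c v" "inverse c"]
        by (cases "c = 0") auto
      then show "x \<in> U"
        using c by simp
    qed
    with that(3) show ?thesis by blast
  qed
  have link: "{U \<in> Q. U \<subseteq> m} = punctured_sphere m" if m: "m \<in> M" for m
  proof -
    have mS: "m \<in> ?S" "m \<notin> Q"
      using m by (auto simp: M_def Q_def)
    have "U \<in> Q" if "U \<in> punctured_sphere m" for U
    proof -
      have U: "U \<in> ?S" "U \<subseteq> m" "U \<noteq> m"
        using that S[OF mS(1)] by (auto simp: punctured_sphere_def)
      then have "U \<notin> M"
        using max m by blast
      with U show ?thesis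
        by (simp add: Q_def M_def)
    qed
    moreover have "U \<in> punctured_sphere m" if "U \<in> Q" "U \<subseteq> m" for U
    proof -
      have "U \<in> ?S" "U \<noteq> m"
        using that mS(2) by (auto simp: Q_def)
      with that(2) show ?thesis
        unfolding punctured_sphere_def by blast
    qed
    moreover have "U \<subseteq> m" if "U \<in> punctured_sphere m" for U
      using that by (simp add: punctured_sphere_def)
    ultimately show ?thesis
      by blast
  qed
  have "Q \<union> M = ?S"
    by (auto simp: Q_def M_def)
  \<comment> \<open>Since \<open>p - 1\<close> is not the exceptional degree of a hyperplane in
    \<open>M\<close>, every link has trivial homology there, so the trivial group is the common
    model.\<close>
  moreover have "reduced_homology_group p (downset_topology (Q \<union> M))
      \<cong> sum_group {..<card M} (\<lambda>_. singleton_group ())"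
  proof (rule reduced_homology_attach_facets)
    show "finite M"
      using V(2) S(2) by (intro finite_subset[of M "Pow V"]) (auto simp: M_def)
    \<comment> \<open>Monotonicity would give
      \<open>V = ?k m \<subseteq> ?k U \<subseteq> V\<close>, against
      \<open>U \<in> Q\<close>.\<close>
    show "\<not> m \<subseteq> U" if "m \<in> M" "U \<in> Q" for m U
      using that k_mono[of m U] kV[of U] S[of U] by (auto simp: M_def Q_def)
    show "red_homology (p - 1) (downset_topology {U \<in> Q. U \<subseteq> m}) \<cong> singleton_group ()" if m: "m \<in> M" for m
    proof -
      have "fv.dim m = Suc k"
        using dim_span_insert[of m v] notin[OF m] V(3) S[of m] m by (auto simp: M_def)
      then have "trivial_group (red_homology (p - 1) (downset_topology (punctured_sphere m)))"
        using S[of m] m Suc.prems(4) by (intro Suc.IH) (auto simp: M_def)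
      then show ?thesis
        unfolding link[OF m] by (intro iso_trivial_groups) auto
    qed
    show "Q \<inter> M = {}"
      by (auto simp: Q_def M_def)
  qed (fact Q max singleton_group)+
  moreover have "trivial_group (sum_group {..<card M} (\<lambda>_. singleton_group ()))"
    by (rule trivial_sum_group) simp
  ultimately have "trivial_group (reduced_homology_group p (downset_topology ?S))"
    using isomorphic_group_triviality[OF _ group_reduced_homology_group sum_group] by (metis singleton_group)
  moreover have "?S \<noteq> {}"
    using line by (auto simp: Q_def)
  ultimately show ?case
    by (simp add: red_homology_nonempty)
qed

theorem theorem5p15:
  fixes \<Delta> :: "(nat \<Rightarrow> 'k :: {field, finite}) set set"
    and F :: "nat \<Rightarrow> (nat \<Rightarrow> 'k) set"
    and n d t l :: nat
  assumes "q_complex (coord_space n) \<Delta>"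
    and "pure_complex \<Delta>"
    and "complex_dim \<Delta> = d"
    and "shelling \<Delta> t F"
    and "1 \<le> l" and "l \<le> t"
    and "contractible_poset (punctured (qgen (F ` {1..l})))"
    and "\<And>i. l < i \<Longrightarrow> i \<le> t \<Longrightarrow>
           punctured (qgen {F i}) \<inter> punctured (qgen (F ` {1..i - 1})) = punctured_sphere (F i)"
  shows "\<forall>p::int.
    (p = int d - 1 \<longrightarrow>
       red_homology p (downset_topology (punctured \<Delta>)) \<cong>
       sum_group {..<t - l}
         (\<lambda>_. red_homology (p - 1)
                (downset_topology (punctured_sphere (coord_space d :: (nat \<Rightarrow> 'k) set))))) \<and>
    (p \<noteq> int d - 1 \<longrightarrow>
       trivial_group (red_homology p (downset_topology (punctured \<Delta>))))"
proof -

  \<comment> \<open>Facets of the shelled complex and their dimension\<close>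
  have \<Delta>: "fv.subspace W" "W \<subseteq> coord_space n" "finite W" if "W \<in> \<Delta>" for W
    using assms(1) that finite_subset[OF _ finite_coord_space] by (auto simp: q_complex_def)
  have \<Delta>_down: "U \<in> \<Delta>" if "W \<in> \<Delta>" "fv.subspace U" "U \<subseteq> W" for U W
    using assms(1) that unfolding q_complex_def by blast
  have fin: "finite \<Delta>"
    using \<Delta>(2) finite_coord_space by (intro finite_subset[of \<Delta> "Pow (coord_space n)"]) auto
  have bij: "inj_on F {1..t}" "F ` {1..t} = facets \<Delta>"
    using assms(4) by (auto simp: shelling_def bij_betw_def)
  have F: "F i \<in> facets \<Delta>" "F i \<in> \<Delta>" if "i \<in> {1..t}" for i
    using bij(2) that unfolding facets_def by blast+
  have facet_eq: "F i = F j" if "i \<in> {1..t}" "j \<in> {1..t}" "F i \<subseteq> F j" for i j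
    using F[OF that(1)] F[OF that(2)] that(3) unfolding facets_def by blast
  have in_facet: "\<exists>i\<in>{1..t}. W \<subseteq> F i" if W: "W \<in> \<Delta>" for W
  proof -
    obtain G where "G \<in> \<Delta>" "W \<subseteq> G" "\<forall>U\<in>\<Delta>. G \<subseteq> U \<longrightarrow> G = U"
      using finite_has_maximal2[OF fin W] by blast
    then have "G \<in> F ` {1..t}"
      unfolding bij(2) facets_def by blast
    with \<open>W \<subseteq> G\<close> show ?thesis by blast
  qed
  \<comment> \<open>The maximum in \<open>complex_dim\<close> runs over all members. It is attained
    at some \<open>W\<close>, hence at a facet containing \<open>W\<close>, and purity carries it to
    every facet.\<close>
  have dim_F: "fv.dim (F i) = d" if i: "i \<in> {1..t}" for i
  proof -
    have "Max (fv.dim ` \<Delta>) \<in> fv.dim ` \<Delta>"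
      using fin F(2)[OF i] by (intro Max_in) auto
    then obtain W where W: "W \<in> \<Delta>" "fv.dim W = d"
      using assms(3) by (auto simp: complex_dim_def)
    obtain j where j: "j \<in> {1..t}" "W \<subseteq> F j"
      using in_facet[OF W(1)] by blast
    have "d \<le> fv.dim (F j)"
      using dim_mono_finite[OF j(2)] \<Delta>(3)[OF F(2)[OF j(1)]] W(2) by simp
    moreover have "fv.dim (F j) \<le> d"
      using assms(3) fin F(2)[OF j(1)] by (auto simp: complex_dim_def)
    moreover have "fv.dim (F i) = fv.dim (F j)"
      using assms(2) F(1)[OF i] F(1)[OF j(1)] unfolding pure_complex_def by blast
    ultimately show ?thesis by simp
  qed

  \<comment> \<open>Decomposition into the contractible part and the attached facets\<close>
  define Q where "Q = punctured (qgen (F ` {1..l}))"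
  define M where "M = F ` {l<..t}"
  have Q_iff: "U \<in> Q \<longleftrightarrow> fv.subspace U \<and> U \<noteq> {0} \<and> (\<exists>j\<in>{1..l}. U \<subseteq> F j)" for U
    by (auto simp: Q_def punctured_def qgen_def)
  \<comment> \<open>Contractibility includes nonemptiness, so some facet contains a nonzero
    subspace. Hence facets are nonzero and \<open>d - 1\<close> is a true predecessor.\<close>
  have d: "d \<noteq> 0"
  proof -
    obtain U where "U \<in> Q"
      using assms(7) by (auto simp: contractible_poset_def Q_def)
    then obtain j where U: "fv.subspace U" "U \<noteq> {0}" "j \<in> {1..l}" "U \<subseteq> F j"
      using Q_iff[of U] by blast
    then have j: "j \<in> {1..t}"
      using assms(6) by auto
    have "finite (F j)"
      using \<Delta>(3) F(2)[OF j] by blast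
    then show ?thesis
      using dim_pos_finite[of U] dim_mono_finite[of U "F j"] dim_F[OF j] U finite_subset[of U "F j"] by auto
  qed
  have proper: "U \<in> Q"
    if "i \<in> {1..t}" "fv.subspace U" "U \<noteq> {0}" "U \<subseteq> F i" "U \<noteq> F i" for i U
    using that
  proof (induction i rule: less_induct)
    case (less i)
    show ?case
    proof (cases "i \<le> l")
      case True
      then show ?thesis
        using less.prems by (auto simp: Q_iff)
    next
      case False
      then have li: "l < i" "i \<le> t"
        using less.prems(1) by auto
      have "U \<in> punctured_sphere (F i)"
        using less.prems unfolding punctured_sphere_def by blast
      then have "U \<in> punctured (qgen (F ` {1..i - 1}))"
        unfolding assms(8)[OF li, symmetric] by blast
      then obtain j where j: "j \<in> {1..i - 1}" "U \<subseteq> F j"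
        unfolding punctured_def qgen_def by blast
      then have jt: "j \<in> {1..t}" "j < i"
        using less.prems(1) by auto
      \<comment> \<open>Otherwise \<open>F j\<close> would lie properly inside \<open>F i\<close>,
        but both are facets.\<close>
      have "U \<noteq> F j"
        using facet_eq[OF jt(1) less.prems(1)] less.prems(4,5) by blast
      then show ?thesis
        using less.IH[OF jt(2,1)] less.prems j(2) by blast
    qed
  qed
  \<comment> \<open>Containment would make two facets coincide whose indices lie on different sides
    of \<open>l\<close>, against injectivity of \<open>F\<close>.\<close>
  have M_notin: "\<not> m \<subseteq> U" if m: "m \<in> M" and U: "U \<in> Q" for m U
  proof
    assume "m \<subseteq> U"
    then obtain i j where ij: "i \<in> {l<..t}" "j \<in> {1..l}" "F i \<subseteq> F j"
      using m U unfolding M_def Q_iff by blast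
    then have "i \<in> {1..t}" "j \<in> {1..t}"
      using assms(5,6) by auto
    then have "i = j"
      using facet_eq ij(3) inj_onD[OF bij(1)] by blast
    with ij show False by auto
  qed
  have F_nz: "F i \<noteq> {0}" if "i \<in> {1..t}" for i
    using dim_F[OF that] d dim_zero_space by metis
  have QM: "punctured \<Delta> = Q \<union> M"
  proof
    show "punctured \<Delta> \<subseteq> Q \<union> M"
    proof
      fix U assume U: "U \<in> punctured \<Delta>"
      then obtain i where i: "i \<in> {1..t}" "U \<subseteq> F i"
        using in_facet[of U] unfolding punctured_def by blast
      have U': "fv.subspace U" "U \<noteq> {0}"
        using U \<Delta>(1)[of U] unfolding punctured_def by blast+
      show "U \<in> Q \<union> M"
      proof (cases "U = F i \<and> l < i")
        case True
        then show ?thesis using i by (auto simp: M_def)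
      next
        case False
        then show ?thesis
          using proper[OF i(1) U' i(2)] i U' Q_iff[of U] by (cases "i \<le> l") auto
      qed
    qed
    show "Q \<union> M \<subseteq> punctured \<Delta>"
    proof
      fix U assume "U \<in> Q \<union> M"
      then show "U \<in> punctured \<Delta>"
      proof
        assume "U \<in> Q"
        then obtain j where "j \<in> {1..l}" "U \<subseteq> F j" "fv.subspace U" "U \<noteq> {0}"
          unfolding Q_iff by blast
        moreover from this have "j \<in> {1..t}"
          using assms(6) by simp
        ultimately show ?thesis
          using \<Delta>_down[OF F(2)] unfolding punctured_def by blast
      next
        assume "U \<in> M"
        then obtain i where "i \<in> {l<..t}" "U = F i"
          unfolding M_def by blast
        moreover from this have "i \<in> {1..t}"
          by simp
        ultimately show ?thesis
          using F(2) F_nz unfolding punctured_def by blast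
      qed
    qed
  qed
  have card_M: "card M = t - l"
    using card_image[OF inj_on_subset[OF bij(1), of "{l<..t}"]] by (simp add: M_def subset_iff)
  \<comment> \<open>The given spheres are links in the complex of all earlier facets; by
    \<open>proper\<close> they already lie in \<open>Q\<close>, so all of \<open>M\<close> can be
    attached to the same \<open>Q\<close>.\<close>
  have link: "{U \<in> Q. U \<subseteq> F i} = punctured_sphere (F i)" if i: "i \<in> {l<..t}" for i
  proof -
    have "i \<in> {1..t}"
      using i by auto
    moreover have "F i \<notin> Q"
      using M_notin[of "F i" "F i"] i by (auto simp: M_def)
    ultimately show ?thesis
      using proper[of i] unfolding punctured_sphere_def by (auto simp: Q_iff)
  qed

  \<comment> \<open>Homology of the punctured complex\<close>
  let ?G = "\<lambda>p. red_homology p (downset_topology (punctured_sphere (coord_space d :: (nat \<Rightarrow> 'k) set)))"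
  \<comment> \<open>This holds in every degree; the two cases of the conclusion separate only
    through the vanishing of the sphere's homology.\<close>
  have main: "red_homology p (downset_topology (punctured \<Delta>)) \<cong> sum_group {..<t - l} (\<lambda>_. ?G (p - 1))" for p
  proof -
    have "reduced_homology_group p (downset_topology (Q \<union> M)) \<cong> sum_group {..<card M} (\<lambda>_. ?G (p - 1))"
    proof (rule reduced_homology_attach_facets)
      show "contractible_poset Q"
        using assms(7) by (simp add: Q_def)
      show "Q \<inter> M = {}"
        using M_notin by blast
      show "U = m" if mU: "m \<in> M" "U \<in> M" "U \<subseteq> m" for m U
      proof -
        obtain i j where ij: "i \<in> {l<..t}" "j \<in> {l<..t}" "U = F i" "m = F j"
          using mU(1,2) unfolding M_def by blast
        then show ?thesis
          using facet_eq[of i j] mU(3) by simp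
      qed
      show "red_homology (p - 1) (downset_topology {U \<in> Q. U \<subseteq> m}) \<cong> ?G (p - 1)" if m: "m \<in> M" for m
      proof -
        obtain i where i: "i \<in> {l<..t}" "m = F i"
          using m unfolding M_def by blast
        then have "i \<in> {1..t}" by auto
        then show ?thesis
          unfolding i(2) link[OF i(1)]
          by (intro red_homology_homeomorphic punctured_sphere_homeomorphic)
             (simp_all add: \<Delta> F dim_F dim_coord_space subspace_coord_space finite_coord_space)
      qed
      show "finite M"
        by (simp add: M_def)
    qed (fact group_red_homology M_notin)+
    moreover have "punctured \<Delta> \<noteq> {}"
      using assms(7) QM by (auto simp: contractible_poset_def Q_def)
    ultimately show ?thesis
      by (simp add: QM card_M red_homology_nonempty)
  qed
  have "trivial_group (red_homology p (downset_topology (punctured \<Delta>)))" if "p \<noteq> int d - 1" for p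
  proof -
    \<comment> \<open>With \<open>k = d - 1\<close> the exceptional degree of the sphere is
      \<open>d - 2\<close>, and \<open>p - 1\<close> differs from it.\<close>
    have "trivial_group (?G (p - 1))"
      using that d
      by (intro trivial_red_homology_punctured_sphere[where k = "d - 1"])
         (auto simp: subspace_coord_space finite_coord_space dim_coord_space of_nat_diff)
    then have "trivial_group (sum_group {..<t - l} (\<lambda>_. ?G (p - 1)))"
      by (intro trivial_sum_group)
    then show ?thesis
      using isomorphic_group_triviality[OF main] by simp
  qed
  with main show ?thesis
    by blast
qed

end
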